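(* Let $M=(m_i)_{i=0}^{\infty}$ be a sequence of integers with $m_0=1$ and $m_i\ge 2$ for $i\ge 1$, and let $M'=(1,m_2,m_3,\ldots)$. Let $k\in\mathbb{N}$. Then for every integer $n\ge \frac{km_1}{m_1-1}$, \[ a_M(n-k,n)=\sum_{\substack{j\in\mathbb{Z}\\ k/m_1\le j\le k/(m_1-1)}}a_{M'}(m_1j-k,j). \] In particular, if $n\ge km_1/(m_1-1)$ and $1\le k\le m_1-2$, then $a_M(n-k,n)=0$.
   Context: For a sequence $N=(n_i)_{i\ge0}$ of integers with $n_0=1$, $n_i\ge2$ for $i\ge1$, put $N_i=\prod_{j=0}^{i}n_j$; then $a_N(j,n)$ denotes the number of representations of $n$ as a sum of exactly $j$ numbers from $\{N_0,N_1,N_2,\ldots\}$ (order irrelevant, repetitions allowed), i.e. the coefficient of $t^j$ in $p_N(n,t)$, where $\prod_{i\ge0}\frac{1}{1-tq^{N_i}}=\sum_n p_N(n,t)q^n$. By convention $a_N(j,n)=0$ if $j<0$ or $j>n$. *)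

theory Defs
  imports Complex_Main "HOL-Library.Multiset"
begin

definition partial_prod :: "(nat \<Rightarrow> int) \<Rightarrow> nat \<Rightarrow> int" where
  "partial_prod N i = (\<Prod>j\<le>i. N j)"

text \<open>
  A representation of \<open>n\<close> with order irrelevant and repetitions allowed is a multiset of parts.
  The conventions \<open>rep_count N j n = 0\<close> for \<open>j < 0\<close> and for \<open>j > n\<close> need no case distinction:
  see \<open>rep_count_neg\<close> and \<open>rep_count_gt\<close> below.
\<close>

definition representations :: "(nat \<Rightarrow> int) \<Rightarrow> int \<Rightarrow> int \<Rightarrow> int multiset set" where
  "representations N j n =
    {X. set_mset X \<subseteq> range (partial_prod N) \<and> int (size X) = j \<and> sum_mset X = n}"

definition rep_count :: "(nat \<Rightarrow> int) \<Rightarrow> int \<Rightarrow> int \<Rightarrow> nat" where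
  "rep_count N j n = card (representations N j n)"

definition drop_first_factor :: "(nat \<Rightarrow> int) \<Rightarrow> nat \<Rightarrow> int" where
  "drop_first_factor M i = (if i = 0 then 1 else M (Suc i))"

lemma rep_count_neg: "j < 0 \<Longrightarrow> rep_count N j n = 0"
  by (auto simp: rep_count_def representations_def)

lemma partial_prod_ge_1:
  assumes "N 0 = 1" and "\<And>i. i \<ge> 1 \<Longrightarrow> N i \<ge> 2"
  shows "partial_prod N i \<ge> 1"
proof -
  have "N j \<ge> 1" for j
    using assms(1) assms(2)[of j] by (cases j) auto
  then show ?thesis
    unfolding partial_prod_def by (intro prod_ge_1) auto
qed

lemma size_le_sum_mset:
  fixes X :: "int multiset"
  assumes "\<And>x. x \<in># X \<Longrightarrow> x \<ge> 1"
  shows "int (size X) \<le> sum_mset X"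
  using assms
proof (induction X)
  case empty
  then show ?case by simp
next
  case (add x X)
  have "int (size X) \<le> sum_mset X"
    by (rule add.IH) (simp add: add.prems)
  moreover have "x \<ge> 1"
    by (simp add: add.prems)
  ultimately show ?case by simp
qed

lemma representations_size_le:
  assumes "N 0 = 1" and "\<And>i. i \<ge> 1 \<Longrightarrow> N i \<ge> 2" and "X \<in> representations N j n"
  shows "j \<le> n"
proof -
  have "x \<ge> 1" if "x \<in># X" for x
    using that assms(3) partial_prod_ge_1[of N, OF assms(1,2)]
    by (auto simp: representations_def)
  then show ?thesis
    using size_le_sum_mset[of X] assms(3) by (auto simp: representations_def)
qed

lemma rep_count_gt:
  assumes "N 0 = 1" and "\<And>i. i \<ge> 1 \<Longrightarrow> N i \<ge> 2" and "j > n"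
  shows "rep_count N j n = 0"
proof -
  have "representations N j n = {}"
    using representations_size_le[of N, OF assms(1,2)] assms(3) by force
  then show ?thesis
    by (simp add: rep_count_def)
qed

lemma finite_representations:
  assumes "N 0 = 1" and "\<And>i. i \<ge> 1 \<Longrightarrow> N i \<ge> 2"
  shows "finite (representations N j n)"
proof (rule finite_subset)
  show "representations N j n \<subseteq> mset ` {xs. set xs \<subseteq> {1..n} \<and> length xs = nat j}"
  proof
    fix X assume X: "X \<in> representations N j n"
    have ge: "x \<ge> 1" if "x \<in># X" for x
      using that X partial_prod_ge_1[of N, OF assms(1,2)]
      by (auto simp: representations_def)
    have le: "x \<le> n" if x: "x \<in># X" for x
    proof -
      obtain Y where Y: "X = add_mset x Y"
        using x by (rule mset_add)
      have "int (size Y) \<le> sum_mset Y"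
        by (rule size_le_sum_mset, rule ge) (simp add: Y)
      moreover have "sum_mset X = n"
        using X by (simp add: representations_def)
      ultimately show ?thesis
        by (simp add: Y)
    qed
    obtain xs where xs: "mset xs = X"
      using ex_mset by blast
    have "set xs \<subseteq> {1..n}"
      using ge le unfolding xs[symmetric] by (simp add: subset_iff)
    moreover have "length xs = nat j"
      using X unfolding xs[symmetric] representations_def by auto
    ultimately show "X \<in> mset ` {xs. set xs \<subseteq> {1..n} \<and> length xs = nat j}"
      using xs by blast
  qed
  show "finite (mset ` {xs. set xs \<subseteq> {1..n} \<and> length xs = nat j})"
    by (intro finite_imageI finite_lists_length_eq) simp
qed

end

theory Submission
  imports Defs
begin

text \<open>
  Every part of \<open>M\<close> other than \<open>1\<close> is \<open>M 1\<close> times a part of \<open>M'\<close>. Removing the ones from a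
  representation of \<open>n\<close> with \<open>n - k\<close> parts and dividing the rest by \<open>M 1\<close> leaves a representation,
  with respect to \<open>M'\<close>, of some \<open>j\<close> with exactly \<open>M 1 * j - k\<close> parts. It can be undone when
  \<open>n - M 1 * j\<close>, the number of ones to be put back, is nonnegative, and the lower bound on \<open>n\<close>
  guarantees this for every \<open>j \<le> k / (M 1 - 1)\<close>.
\<close>

text \<open>Since \<open>M 0 = 1\<close>, the product up to index \<open>Suc i\<close> is
  \<open>M 1\<close> times a product of factors with index at least 2, which is what
  \<open>drop_first_factor\<close> keeps.\<close>

lemma partial_prod_Suc_drop_first_factor:
  assumes "M 0 = 1"
  shows "partial_prod M (Suc i) = M 1 * partial_prod (drop_first_factor M) i"
proof (induction i)
  case 0
  then show ?case
    using assms by (simp add: partial_prod_def drop_first_factor_def)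
next
  case (Suc i)
  have "partial_prod M (Suc (Suc i)) = partial_prod M (Suc i) * M (Suc (Suc i))"
    by (simp add: partial_prod_def mult.commute)
  also have "\<dots> = M 1 * (partial_prod (drop_first_factor M) i * drop_first_factor M (Suc i))"
    by (simp add: Suc.IH drop_first_factor_def[of M "Suc i"])
  also have "\<dots> = M 1 * partial_prod (drop_first_factor M) (Suc i)"
    by (simp add: partial_prod_def mult.commute)
  finally show ?case .
qed

lemma range_partial_prod:
  assumes "M 0 = 1"
  shows "range (partial_prod M) =
    insert 1 ((*) (M 1) ` range (partial_prod (drop_first_factor M)))"
proof -
  have "range (partial_prod M) = insert (partial_prod M 0) (range (\<lambda>i. partial_prod M (Suc i)))"
    proof -
    have "(UNIV :: nat set) = insert 0 (range Suc)"
      using nat.exhaust by auto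
    then show ?thesis
      by (metis image_insert image_image)
  qed
  then show ?thesis
    using assms by (simp only: partial_prod_Suc_drop_first_factor image_image)
      (simp add: partial_prod_def)
qed

text \<open>The number \<open>c\<close> of ones is a separate argument because \<open>Y\<close> does
  not determine it; below it becomes \<open>n - m * j\<close>.\<close>

definition scale_and_pad :: "int \<Rightarrow> nat \<Rightarrow> int multiset \<Rightarrow> int multiset" where
  "scale_and_pad m c Y = replicate_mset c 1 + image_mset ((*) m) Y"

definition strip_and_divide :: "int \<Rightarrow> int multiset \<Rightarrow> int multiset" where
  "strip_and_divide m X = image_mset (\<lambda>x. x div m) (filter_mset (\<lambda>x. x \<noteq> 1) X)"

lemma size_scale_and_pad [simp]: "size (scale_and_pad m c Y) = c + size Y"
  by (simp add: scale_and_pad_def)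

lemma sum_mset_scale_and_pad [simp]: "sum_mset (scale_and_pad m c Y) = int c + m * sum_mset Y"
  by (simp add: scale_and_pad_def flip: sum_mset_distrib_left)

text \<open>For \<open>m \<ge> 2\<close> no multiple of \<open>m\<close> equals 1, so the filter
  removes exactly the padding.\<close>

lemma strip_and_divide_scale_and_pad:
  assumes "m \<ge> 2"
  shows "strip_and_divide m (scale_and_pad m c Y) = Y"
proof -
  have "filter_mset (\<lambda>x. x \<noteq> 1) (image_mset ((*) m) Y) = image_mset ((*) m) Y"
    using assms by (auto simp: filter_mset_eq_conv zmult_eq_1_iff)
  moreover have "filter_mset (\<lambda>x. x \<noteq> 1) (replicate_mset c 1) = {#}"
    by (auto simp: filter_mset_eq_conv)
  ultimately have "strip_and_divide m (scale_and_pad m c Y) = image_mset (\<lambda>y. m * y div m) Y"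
    by (simp add: strip_and_divide_def scale_and_pad_def multiset.map_comp comp_def)
  also have "\<dots> = Y"
    using assms by simp
  finally show ?thesis .
qed

text \<open>Every element other than 1 is a multiple of \<open>m\<close>, so \<open>div\<close> is
  exact on it, and \<open>count X 1\<close> restores the ones that were filtered out.\<close>

lemma scale_and_pad_strip_and_divide:
  assumes "set_mset X \<subseteq> insert 1 ((*) m ` A)" and "m \<noteq> 0"
  shows "scale_and_pad m (count X 1) (strip_and_divide m X) = X"
proof -
  have "image_mset (\<lambda>x. m * (x div m)) (filter_mset (\<lambda>x. x \<noteq> 1) X) = filter_mset (\<lambda>x. x \<noteq> 1) X"
    using assms by (intro multiset.map_ident_strong) auto
  moreover have "replicate_mset (count X 1) 1 = filter_mset (\<lambda>x. x = 1) X"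
    by (simp add: filter_eq_replicate_mset)
  ultimately show ?thesis
    by (simp add: scale_and_pad_def strip_and_divide_def multiset.map_comp comp_def
        flip: multiset_partition)
qed

lemma set_mset_strip_and_divide:
  assumes "set_mset X \<subseteq> insert 1 ((*) m ` A)" and "m \<noteq> 0"
  shows "set_mset (strip_and_divide m X) \<subseteq> A"
  using assms by (auto simp: strip_and_divide_def)

text \<open>The counting identity with all denominators cleared, proved by a bijection onto the
  disjoint union of the representation sets over \<open>j\<close> in \<open>J\<close>.\<close>

lemma rep_count_diff_eq_sum:
  fixes M :: "nat \<Rightarrow> int" and k n :: int
  assumes M0: "M 0 = 1" and M_ge: "\<And>i. i \<ge> 1 \<Longrightarrow> M i \<ge> 2"
    and n: "k * M 1 \<le> n * (M 1 - 1)"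
  defines "J \<equiv> {j. k \<le> M 1 * j \<and> (M 1 - 1) * j \<le> k}"
  shows "rep_count M (n - k) n = (\<Sum>j\<in>J. rep_count (drop_first_factor M) (M 1 * j - k) j)"
proof -
  define m where "m = M 1"
  define M' where "M' = drop_first_factor M"
  have m: "m \<ge> 2"
    using M_ge[of 1] by (simp add: m_def)
  have M': "M' 0 = 1" "\<And>i. i \<ge> 1 \<Longrightarrow> M' i \<ge> 2"
    using M_ge by (auto simp: M'_def drop_first_factor_def)
  have range_M: "range (partial_prod M) = insert 1 ((*) m ` range (partial_prod M'))"
    unfolding m_def M'_def using M0 by (rule range_partial_prod)
  have J: "j \<in> J \<longleftrightarrow> k \<le> m * j \<and> (m - 1) * j \<le> k" for j
    by (simp add: J_def m_def)
  \<comment> \<open>Scaling the upper bound on \<open>j\<close> by \<open>m\<close> and comparing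
    with the hypothesis on \<open>n\<close> allows \<open>m - 1 > 0\<close> to be cancelled. Hence
    \<open>nat (n - m * j)\<close> below truncates nothing.\<close>
  have le_n: "m * j \<le> n" if "j \<in> J" for j
  proof -
    have "(m - 1) * (m * j) = m * ((m - 1) * j)"
      by simp
    also have "\<dots> \<le> m * k"
      using that m by (intro mult_left_mono) (auto simp: J)
    also have "\<dots> \<le> (m - 1) * n"
      using n by (simp add: m_def mult.commute)
    finally show ?thesis
      using m by simp
  qed
  have finite_J: "finite J"
  proof (rule finite_subset)
    show "J \<subseteq> {- \<bar>k\<bar>..\<bar>k\<bar>}"
    proof
      fix j assume "j \<in> J"
      then have j: "k \<le> m * j" "(m - 1) * j \<le> k"
        by (auto simp: J)
      \<comment> \<open>Subtract the upper bound \<open>(m - 1) * j \<le> k\<close> from the lower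
        bound \<open>k \<le> m * j\<close>.\<close>
      then have "0 \<le> j"
        by (simp add: algebra_simps)
      moreover have "1 * j \<le> (m - 1) * j"
        using m \<open>0 \<le> j\<close> by (intro mult_right_mono) auto
      ultimately show "j \<in> {- \<bar>k\<bar>..\<bar>k\<bar>}"
        using j by auto
    qed
  qed simp
  let ?R = "SIGMA j:J. representations M' (m * j - k) j"
  \<comment> \<open>The index \<open>j\<close> is the sum of \<open>Y\<close>, so the inverse can
    read it off after stripping.\<close>
  have "bij_betw (\<lambda>(j, Y). scale_and_pad m (nat (n - m * j)) Y) ?R (representations M (n - k) n)"
  proof (rule bij_betw_byWitness
      [where f' = "\<lambda>X. (sum_mset (strip_and_divide m X), strip_and_divide m X)"])
    show "\<forall>p\<in>?R. (\<lambda>X. (sum_mset (strip_and_divide m X), strip_and_divide m X))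
        ((\<lambda>(j, Y). scale_and_pad m (nat (n - m * j)) Y) p) = p"
      using m by (auto simp: strip_and_divide_scale_and_pad representations_def)
    have "sum_mset (strip_and_divide m X) \<in> J
        \<and> strip_and_divide m X \<in> representations M'
            (m * sum_mset (strip_and_divide m X) - k) (sum_mset (strip_and_divide m X))
        \<and> scale_and_pad m (nat (n - m * sum_mset (strip_and_divide m X))) (strip_and_divide m X) = X"
      if X: "X \<in> representations M (n - k) n" for X
    proof -
      define Y where "Y = strip_and_divide m X"
      have parts: "set_mset X \<subseteq> insert 1 ((*) m ` range (partial_prod M'))"
        using X by (simp add: representations_def range_M)
      have X_eq: "scale_and_pad m (count X 1) Y = X"
        unfolding Y_def using parts m by (intro scale_and_pad_strip_and_divide) auto
      have sum: "int (count X 1) + m * sum_mset Y = n"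
        using X sum_mset_scale_and_pad[of m "count X 1" Y]
        by (simp add: X_eq representations_def)
      have size: "int (count X 1) + int (size Y) = n - k"
        using X size_scale_and_pad[of m "count X 1" Y]
        by (simp add: X_eq representations_def)
      \<comment> \<open>Subtracting \<open>size\<close> from \<open>sum\<close> eliminates the
        number of ones and leaves \<open>m * sum_mset Y - k\<close> as the size of
        \<open>Y\<close>.\<close>
      have Y: "Y \<in> representations M' (m * sum_mset Y - k) (sum_mset Y)"
        unfolding representations_def
        using set_mset_strip_and_divide[OF parts] m sum size by (simp add: Y_def)
      have "m * sum_mset Y - k \<le> sum_mset Y"
        using M' Y by (rule representations_size_le)
      \<comment> \<open>The upper bound in \<open>J\<close> says that \<open>Y\<close> has at most
        as many parts as its sum; the lower bound says that its size is nonnegative.\<close>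
      then have "sum_mset Y \<in> J"
        using sum size by (simp add: J algebra_simps)
      moreover have "nat (n - m * sum_mset Y) = count X 1"
        using sum by simp
      ultimately show ?thesis
        using X_eq Y by (simp add: Y_def)
    qed
    then show "\<forall>X\<in>representations M (n - k) n.
        (\<lambda>(j, Y). scale_and_pad m (nat (n - m * j)) Y)
          (sum_mset (strip_and_divide m X), strip_and_divide m X) = X"
      and "(\<lambda>X. (sum_mset (strip_and_divide m X), strip_and_divide m X))
        ` representations M (n - k) n \<subseteq> ?R"
      by auto
    have "scale_and_pad m (nat (n - m * j)) Y \<in> representations M (n - k) n"
      if "j \<in> J" and Y: "Y \<in> representations M' (m * j - k) j" for j Y
    proof -
      have "set_mset (scale_and_pad m (nat (n - m * j)) Y) \<subseteq> range (partial_prod M)"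
        using Y unfolding range_M scale_and_pad_def representations_def
        by (auto split: if_splits)
      then show ?thesis
        using Y le_n[OF \<open>j \<in> J\<close>] by (simp add: representations_def)
    qed
    then show "(\<lambda>(j, Y). scale_and_pad m (nat (n - m * j)) Y) ` ?R \<subseteq> representations M (n - k) n"
      by auto
  qed
  then have "card (representations M (n - k) n) = card ?R"
    by (simp add: bij_betw_same_card)
  also have "\<dots> = (\<Sum>j\<in>J. card (representations M' (m * j - k) j))"
    using finite_J finite_representations[of M', OF M'] by (simp add: card_SigmaI)
  finally show ?thesis
    by (simp add: rep_count_def m_def M'_def)
qed

theorem theorem6p8:
  fixes M :: "nat \<Rightarrow> int" and k :: nat and n :: int
  assumes "M 0 = 1"
    and "\<And>i. i \<ge> 1 \<Longrightarrow> M i \<ge> 2"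
    and "real_of_int n \<ge> real k * real_of_int (M 1) / (real_of_int (M 1) - 1)"
  shows "rep_count M (n - int k) n =
           (\<Sum>j \<in> {j::int. real k / real_of_int (M 1) \<le> real_of_int j \<and>
                           real_of_int j \<le> real k / (real_of_int (M 1) - 1)}.
              rep_count (drop_first_factor M) (M 1 * j - int k) j)
         \<and> (1 \<le> k \<and> int k \<le> M 1 - 2 \<longrightarrow> rep_count M (n - int k) n = 0)"
proof -
  have m: "M 1 \<ge> 2"
    using assms(2)[of 1] by simp
  have "real k * real_of_int (M 1) \<le> real_of_int n * (real_of_int (M 1) - 1)"
    using assms(3) m by (simp add: pos_divide_le_eq)
  then have "real_of_int (int k * M 1) \<le> real_of_int (n * (M 1 - 1))"
    by simp
  then have n: "int k * M 1 \<le> n * (M 1 - 1)"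
    by (simp only: of_int_le_iff)
  \<comment> \<open>Both denominators are positive because \<open>M 1 \<ge> 2\<close>, so the real
    bounds on \<open>j\<close> turn into the integer inequalities of
    \<open>rep_count_diff_eq_sum\<close>.\<close>
  have lower: "real k / real_of_int (M 1) \<le> real_of_int j \<longleftrightarrow> int k \<le> M 1 * j" for j
  proof -
    have "real k / real_of_int (M 1) \<le> real_of_int j
        \<longleftrightarrow> real_of_int (int k) \<le> real_of_int (M 1 * j)"
      using m by (simp add: pos_divide_le_eq mult.commute)
    then show ?thesis
      by (simp only: of_int_le_iff)
  qed
  have upper: "real_of_int j \<le> real k / (real_of_int (M 1) - 1) \<longleftrightarrow> (M 1 - 1) * j \<le> int k" for j
  proof -
    have "real_of_int j \<le> real k / (real_of_int (M 1) - 1)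
        \<longleftrightarrow> real_of_int ((M 1 - 1) * j) \<le> real_of_int (int k)"
      using m by (simp add: pos_le_divide_eq mult.commute)
    then show ?thesis
      by (simp only: of_int_le_iff)
  qed
  have count: "rep_count M (n - int k) n = (\<Sum>j\<in>{j. int k \<le> M 1 * j \<and> (M 1 - 1) * j \<le> int k}.
      rep_count (drop_first_factor M) (M 1 * j - int k) j)"
    using assms(1,2) n by (rule rep_count_diff_eq_sum)
  \<comment> \<open>For these \<open>k\<close> both ends of the interval for \<open>j\<close> lie
    strictly between 0 and 1, so it contains no integer.\<close>
  have "{j. int k \<le> M 1 * j \<and> (M 1 - 1) * j \<le> int k} = {}" if k: "1 \<le> k" "int k \<le> M 1 - 2"
  proof -
    have False if j: "int k \<le> M 1 * j" "(M 1 - 1) * j \<le> int k" for j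
    proof -
      have "0 < M 1 * j"
        using j(1) k(1) by linarith
      then have "1 \<le> j"
        using m by (simp add: zero_less_mult_iff)
      then have "(M 1 - 1) * 1 \<le> (M 1 - 1) * j"
        using m by (intro mult_left_mono) auto
      then show False
        using j(2) k(2) by simp
    qed
    then show ?thesis
      by blast
  qed
  then have "rep_count M (n - int k) n = 0" if "1 \<le> k" "int k \<le> M 1 - 2"
    using that by (simp only: count sum.empty)
  then show ?thesis
    unfolding lower upper using count by blast
qed

end
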